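(* Let $m\ge 4$ be an integer (so that $S=\{2,m,m+2\}$ is admissible). Then $$p(\{2,m,m+2\};n)=m(m-3)\binom{n}{m+1}-2(m-3)\binom{n-2}{m-1}-2(m-2)\binom{n-2}{m-2}+2\binom{n-2}{1},$$ i.e. $\#P(\{2,m,m+2\};n)=p(\{2,m,m+2\};n)\,2^{n-4}$ for all $n\ge m+3$.
   Context: For a permutation $\pi=a_1\ldots a_n$ of $\{1,\ldots,n\}$, an index $i$ is a peak if $a_{i-1}<a_i>a_{i+1}$. $P(S;n)$ is the set of permutations of $\{1,\dots,n\}$ whose set of peaks is exactly $S$. For an admissible finite set $S$ (i.e. $\#P(S;n)\neq 0$ for some $n$), the peak polynomial $p(S;n)$ is the unique polynomial with $\#P(S;n)=p(S;n)2^{n-\#S-1}$ for all $n>\max S$. *)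

theory Defs
  imports Complex_Main "HOL-Combinatorics.Permutations" "HOL-Computational_Algebra.Polynomial"
begin

definition peaks :: "nat \<Rightarrow> (nat \<Rightarrow> nat) \<Rightarrow> nat set" where
  "peaks n \<pi> = {i. 1 < i \<and> i < n \<and> \<pi> (i - 1) < \<pi> i \<and> \<pi> i > \<pi> (i + 1)}"

definition peak_perms :: "nat set \<Rightarrow> nat \<Rightarrow> (nat \<Rightarrow> nat) set" where
  "peak_perms S n = {\<pi>. \<pi> permutes {1..n} \<and> peaks n \<pi> = S}"

definition admissible :: "nat set \<Rightarrow> bool" where
  "admissible S \<longleftrightarrow> (\<exists>n. card (peak_perms S n) \<noteq> 0)"

(* Max (insert 0 S) is the convention max {} = 0. For admissible S and n > max S the
   exponent n - card S - 1 does not truncate. *)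
definition is_peak_poly :: "nat set \<Rightarrow> real poly \<Rightarrow> bool" where
  "is_peak_poly S p \<longleftrightarrow>
     (\<forall>n. n > Max (insert 0 S) \<longrightarrow>
        real (card (peak_perms S n)) = poly p (real n) * 2 ^ (n - card S - 1))"

definition peak_poly :: "nat set \<Rightarrow> real poly" where
  "peak_poly S = (THE p. is_peak_poly S p)"

end

theory Submission
  imports Defs "HOL-Combinatorics.Multiset_Permutations" "HOL-Library.Infinite_Set"
begin

text \<open>
  Let \<open>S\<close> consist of numbers below \<open>k < n\<close>. Choosing the set of the first \<open>k\<close> values, arranging it
  with peak set \<open>S\<close> and arranging the rest without peaks gives
  \<open>#P(S;n) + #P(S \<union> {k};n) + #P(S \<union> {k+1};n) = (n choose k) #P(S;k) 2^(n-k-1)\<close>.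
  With \<open>S = {2}\<close> this determines \<open>#P({2,m};n)\<close> by induction on \<open>m\<close>. With \<open>S = {2,m}\<close> and
  \<open>k = m + 1\<close> the second summand is zero, since two adjacent positions cannot both be peaks, and
  the formula for \<open>{2,m,m+2}\<close> follows.
\<close>

section \<open>Peaks of words, prefixes and suffixes\<close>

text \<open>Positions are numbered from 1, as in \<^const>\<open>peaks\<close>, although list indices start at 0.\<close>

definition list_peaks :: "'a::linorder list \<Rightarrow> nat set" where
  "list_peaks xs =
     {i. 1 < i \<and> i < length xs \<and> xs ! (i - 2) < xs ! (i - 1) \<and> xs ! i < xs ! (i - 1)}"

text \<open>The entries may form any ordered set, because cutting a word leaves parts whose values
  are arbitrary subsets.\<close>

definition peak_words :: "'a::linorder set \<Rightarrow> nat set \<Rightarrow> 'a list set" where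
  "peak_words A S = {xs \<in> permutations_of_set A. list_peaks xs = S}"

lemma finite_peak_words [simp]: "finite (peak_words A S)"
  by (simp add: peak_words_def)

lemma length_peak_words: "xs \<in> peak_words A S \<Longrightarrow> length xs = card A"
  by (auto simp: peak_words_def permutations_of_set_def distinct_card)

text \<open>A peak at \<open>i < k\<close> has its right neighbour at \<open>i + 1 \<le> k\<close>,
  inside the prefix; a peak at \<open>k\<close> is lost with its neighbour.\<close>

lemma list_peaks_take: "list_peaks (take k xs) = list_peaks xs \<inter> {..<k}"
  by (auto simp: list_peaks_def)

text \<open>Position \<open>i\<close> of the suffix is position \<open>k + i\<close> of the word. A
  peak at \<open>k + 1\<close> loses its left neighbour, hence \<open>1 < i\<close>.\<close>

lemma list_peaks_drop: "list_peaks (drop k xs) = {i. 1 < i \<and> k + i \<in> list_peaks xs}"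
proof (cases "k \<le> length xs")
  case True
  have "k + i - 2 = k + (i - 2)" "k + i - 1 = k + (i - 1)" if "1 < i" for i
    using that by auto
  then show ?thesis using True
    by (auto simp: list_peaks_def)
qed (auto simp: list_peaks_def)

lemma list_peaks_Suc_notin: "i \<in> list_peaks xs \<Longrightarrow> Suc i \<notin> list_peaks xs"
  by (auto simp: list_peaks_def)

section \<open>Permutations as words\<close>

lemma permutes_map_upt_bij_betw:
  "bij_betw (\<lambda>\<pi>. map \<pi> [1..<Suc n]) {\<pi>. \<pi> permutes {1..n}} (permutations_of_set {1..n})"
proof -
  let ?F = "\<lambda>\<pi>. map \<pi> [1..<Suc n]" and ?P = "{\<pi>. \<pi> permutes {1..n}}"
  have inj: "inj_on ?F ?P"
  proof (rule inj_onI)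
    fix \<pi> \<sigma> assume *: "\<pi> \<in> ?P" "\<sigma> \<in> ?P" and eq: "?F \<pi> = ?F \<sigma>"
    have "\<pi> i = \<sigma> i" for i
    proof (cases "i \<in> {1..n}")
      case True
      then have "i \<in> set [1..<Suc n]" by auto
      then show ?thesis using eq unfolding map_eq_conv by blast
    next
      case False
      then show ?thesis using * by (auto simp: permutes_def)
    qed
    then show "\<pi> = \<sigma>" by blast
  qed
  have sub: "?F ` ?P \<subseteq> permutations_of_set {1..n}"
  proof
    fix xs assume "xs \<in> ?F ` ?P"
    then obtain \<pi> where \<pi>: "\<pi> permutes {1..n}" "xs = ?F \<pi>" by blast
    have "set xs = {1..n}"
      using permutes_image[OF \<pi>(1)] \<pi>(2)
      by (simp only: set_map set_upt atLeastLessThanSuc_atLeastAtMost)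
    moreover have "distinct xs"
      using permutes_inj_on[OF \<pi>(1)] \<pi>(2) by (simp only: distinct_map distinct_upt)
    ultimately show "xs \<in> permutations_of_set {1..n}" by blast
  qed
  \<comment> \<open>Surjectivity by counting: both sets have \<open>fact n\<close> elements.\<close>
  have "card (?F ` ?P) = card (permutations_of_set {1..n})"
    using card_permutations[of "{1..n}" n] unfolding card_image[OF inj] by simp
  then have "?F ` ?P = permutations_of_set {1..n}"
    using sub by (intro card_subset_eq) auto
  then show ?thesis using inj by (simp add: bij_betw_def)
qed

lemma list_peaks_map_upt: "list_peaks (map \<pi> [1..<Suc n]) = peaks n \<pi>"
proof -
  have "(map \<pi> [1..<Suc n]) ! j = \<pi> (j + 1)" if "j < n" for j
    using that by (simp del: upt_Suc)
  then show ?thesis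
    by (auto simp: list_peaks_def peaks_def Suc_diff_Suc numeral_2_eq_2 simp del: upt_Suc)
qed

lemma card_peak_perms: "card (peak_perms S n) = card (peak_words {1..n} S)"
proof -
  let ?F = "\<lambda>\<pi>::nat\<Rightarrow>nat. map \<pi> [1..<Suc n]"
  have "inj_on ?F (peak_perms S n)"
    using permutes_map_upt_bij_betw[of n]
    by (auto simp: bij_betw_def peak_perms_def intro: inj_on_subset)
  moreover have "?F ` peak_perms S n = peak_words {1..n} S"
    unfolding peak_perms_def peak_words_def
      bij_betw_imp_surj_on[OF permutes_map_upt_bij_betw, symmetric]
    using list_peaks_map_upt[of _ n] by blast
  ultimately show ?thesis by (metis card_image)
qed

section \<open>Invariance under increasing relabelling\<close>

lemma list_peaks_map_strict_mono_on:
  assumes "strict_mono_on A f" "set xs \<subseteq> A"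
  shows "list_peaks (map f xs) = list_peaks xs"
proof -
  have "f (xs ! i) < f (xs ! j) \<longleftrightarrow> xs ! i < xs ! j" if "i < length xs" "j < length xs" for i j
    using assms that nth_mem by (intro strict_mono_on_less[OF assms(1)]) auto
  then show ?thesis by (auto simp: list_peaks_def)
qed

lemma card_peak_words_image:
  assumes "strict_mono_on A f"
  shows "card (peak_words (f ` A) S) = card (peak_words A S)"
proof -
  have inj: "inj_on f A" using assms by (rule strict_mono_on_imp_inj_on)
  have "peak_words (f ` A) S = map f ` peak_words A S"
    using list_peaks_map_strict_mono_on[OF assms]
    by (auto simp: peak_words_def permutations_of_set_image_inj[OF inj] dest: permutations_of_setD)
  moreover have "inj_on (map f) (peak_words A S)"
    using inj
    by (auto simp: peak_words_def intro!: inj_on_mapI inj_on_subset[OF inj] dest: permutations_of_setD)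
  ultimately show ?thesis by (simp add: card_image)
qed

text \<open>Both sets are increasing images of the same initial segment of the naturals, and
  increasing relabelling keeps all comparisons.\<close>

lemma card_peak_words_cong:
  fixes A :: "'a::wellorder set" and B :: "'b::wellorder set"
  assumes "finite A" "finite B" "card A = card B"
  shows "card (peak_words A S) = card (peak_words B S)"
proof -
  obtain f where f: "bij_betw f {..<card A} A" "strict_mono_on {..<card A} f"
    using ex_bij_betw_strict_mono_card[OF assms(1)] .
  obtain g where g: "bij_betw g {..<card B} B" "strict_mono_on {..<card B} g"
    using ex_bij_betw_strict_mono_card[OF assms(2)] .
  have "card (peak_words A S) = card (peak_words {..<card A} S)"
    using card_peak_words_image[OF f(2)] f(1) by (simp add: bij_betw_def)
  also have "\<dots> = card (peak_words B S)"
    using card_peak_words_image[OF g(2)] g(1) assms(3) by (simp add: bij_betw_def)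
  finally show ?thesis .
qed

section \<open>Words without peaks\<close>

text \<open>A maximum with neighbours on both sides is a peak, so it must stand at an end; placed
  there, it creates no peak.\<close>

lemma peak_words_insert_max_empty:
  assumes M: "\<And>x. x \<in> B \<Longrightarrow> x < M"
  shows "peak_words (insert M B) {} = (#) M ` peak_words B {} \<union> (\<lambda>xs. xs @ [M]) ` peak_words B {}"
    (is "?L = ?R")
proof (intro equalityI subsetI)
  fix w assume w: "w \<in> ?L"
  then have set: "set w = insert M B" and dist: "distinct w" and np: "list_peaks w = {}"
    by (auto simp: peak_words_def permutations_of_set_def)
  from set have "M \<in> set w" by simp
  then obtain us vs where uv: "w = us @ M # vs" by (meson split_list)
  have "us = [] \<or> vs = []"
  proof (rule ccontr)
    assume "\<not> (us = [] \<or> vs = [])"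
    then obtain us' a b vs' where "w = us' @ [a, M, b] @ vs'"
      using uv by (cases us rule: rev_cases; cases vs) auto
    moreover have "a \<in> B" "b \<in> B" using calculation dist set by auto
    then have "a < M" "b < M" using M by blast+
    ultimately have "length us' + 2 \<in> list_peaks w"
      by (auto simp: list_peaks_def nth_append)
    then show False using np by simp
  qed
  then show "w \<in> ?R"
  proof
    assume "us = []"
    then have "w = M # vs" and "list_peaks (drop 1 w) = {}"
      using uv np unfolding list_peaks_drop by auto
    moreover have "M \<notin> B" using M by blast
    ultimately show ?thesis using set dist
      by (auto simp: peak_words_def permutations_of_set_def insert_ident)
  next
    assume "vs = []"
    then have "w = us @ [M]" and "list_peaks (take (length us) w) = {}"
      using uv np unfolding list_peaks_take by auto
    moreover have "M \<notin> B" using M by blast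
    ultimately show ?thesis using set dist
      by (auto simp: peak_words_def permutations_of_set_def insert_ident)
  qed
next
  fix w assume "w \<in> ?R"
  then obtain xs where xs: "xs \<in> peak_words B {}" and w: "w = M # xs \<or> w = xs @ [M]" by blast
  have set: "set xs = B" "distinct xs" and np: "list_peaks xs = {}"
    using xs by (auto simp: peak_words_def permutations_of_set_def)
  have "M \<notin> B" using M by blast
  have "i \<notin> list_peaks w" for i
    using w
  proof
    assume w: "w = M # xs"
    show ?thesis
    \<comment> \<open>Position 2 is the only one whose left neighbour is the new entry
      \<open>M\<close>; any later peak would already be a peak of \<open>xs\<close>.\<close>
    proof (cases "i = 2")
      case True
      have "\<not> M < xs ! 0" if "xs \<noteq> []" using M[of "xs ! 0"] that set(1) by fastforce
      with True show ?thesis by (cases xs) (auto simp: w list_peaks_def)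
    next
      case False
      have "drop 1 w = xs" using w by simp
      then have "\<not> (1 < j \<and> 1 + j \<in> list_peaks w)" for j
        using np list_peaks_drop[of 1 w] by auto
      from this[of "i - 1"] show ?thesis using False
        by (auto simp: list_peaks_def numeral_2_eq_2)
    qed
  next
    assume w: "w = xs @ [M]"
    show ?thesis
    proof (cases "i < length xs")
      case True
      have "take (length xs) w = xs" using w by simp
      then show ?thesis using np list_peaks_take[of "length xs" w] True by auto
    next
      \<comment> \<open>The only candidate left is \<open>i = length xs\<close>, whose right
        neighbour \<open>M\<close> is larger.\<close>
      case False
      then show ?thesis using M[of "xs ! (i - 1)"] set nth_mem[of "i - 1" xs]
        by (auto simp: w list_peaks_def nth_append)
    qed
  qed
  then show "w \<in> ?L" using w set \<open>M \<notin> B\<close>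
    by (auto simp: peak_words_def permutations_of_set_def)
qed

text \<open>Adding the elements in increasing order, each new maximum has two possible ends and so
  doubles the count. For the first element the two ends coincide, which gives the exponent
  \<open>card A - 1\<close>.\<close>

lemma card_peak_words_empty:
  assumes "finite A" "A \<noteq> {}"
  shows "card (peak_words A {}) = 2 ^ (card A - 1)"
  using assms
proof (induction rule: finite_linorder_max_induct)
  case empty
  then show ?case by simp
next
  case (insert M B)
  show ?case
  proof (cases "B = {}")
    case True
    then have "peak_words (insert M B) {} = {[M]}"
      by (auto simp: peak_words_def list_peaks_def)
    then show ?thesis using True by simp
  next
    case False
    have notin: "M \<notin> B" using insert.hyps by blast
    \<comment> \<open>A word with \<open>M\<close> at both ends would repeat \<open>M\<close>, as
      \<open>B\<close> is nonempty.\<close>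
    have disj: "(#) M ` peak_words B {} \<inter> (\<lambda>xs. xs @ [M]) ` peak_words B {} = {}"
    proof -
      have False if "xs \<in> peak_words B {}" "ys \<in> peak_words B {}" "M # xs = ys @ [M]" for xs ys
        using that False notin
        by (cases ys) (auto simp: peak_words_def permutations_of_set_def)
      then show ?thesis by blast
    qed
    have "card (peak_words (insert M B) {}) = card (peak_words B {}) + card (peak_words B {})"
      using insert.hyps
      by (subst peak_words_insert_max_empty) (auto simp: card_Un_disjoint[OF _ _ disj] card_image inj_on_def)
    also have "\<dots> = 2 ^ card B"
      using insert.IH[OF False] insert.hyps(1) False
      by (cases "card B") (auto simp: card_gt_0_iff)
    finally show ?thesis using notin insert.hyps(1) by simp
  qed
qed

section \<open>Cutting a word and the recurrence\<close>

text \<open>A word amounts to the set \<open>Y\<close> of its first \<open>k\<close> values, an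
  arrangement of \<open>Y\<close> and one of \<open>A - Y\<close>. The numbers of arrangements
  depend only on the sizes, so each of the \<open>n choose k\<close> sets \<open>Y\<close>
  contributes equally.\<close>

lemma card_words_split:
  fixes A :: "'a::wellorder set"
  assumes A: "finite A" "card A = n" and k: "k \<le> n"
  shows "card {w \<in> permutations_of_set A. list_peaks (take k w) = S \<and> list_peaks (drop k w) = T} =
     (n choose k) * card (peak_words {1..k} S) * card (peak_words {1..n - k} T)"
    (is "card ?W = _")
proof -
  let ?Y = "{Y. Y \<subseteq> A \<and> card Y = k}"
  let ?X = "SIGMA Y:?Y. peak_words Y S \<times> peak_words (A - Y) T"
  have "bij_betw (\<lambda>(Y, xs, ys). xs @ ys) ?X ?W"
  proof (rule bij_betw_byWitness[where f' = "\<lambda>w. (set (take k w), take k w, drop k w)"])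
    have len: "length w = n" if "w \<in> permutations_of_set A" for w
      using that A by (auto simp: permutations_of_set_def distinct_card)
    show "\<forall>a\<in>?X. (\<lambda>w. (set (take k w), take k w, drop k w)) ((\<lambda>(Y, xs, ys). xs @ ys) a) = a"
    proof
      fix a assume "a \<in> ?X"
      then obtain Y xs ys where a: "a = (Y, xs, ys)" and "Y \<subseteq> A" "card Y = k"
        and xs: "xs \<in> peak_words Y S" by blast
      then have "length xs = k" by (simp add: length_peak_words)
      moreover have "set xs = Y" using xs by (auto simp: peak_words_def dest: permutations_of_setD)
      ultimately show "(\<lambda>w. (set (take k w), take k w, drop k w)) ((\<lambda>(Y, xs, ys). xs @ ys) a) = a"
        by (simp add: a)
    qed
    show "\<forall>w\<in>?W. (\<lambda>(Y, xs, ys). xs @ ys) (set (take k w), take k w, drop k w) = w"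
      by simp
    show "(\<lambda>(Y, xs, ys). xs @ ys) ` ?X \<subseteq> ?W"
    proof
      fix w assume "w \<in> (\<lambda>(Y, xs, ys). xs @ ys) ` ?X"
      then obtain Y xs ys where Y: "Y \<subseteq> A" "card Y = k" and xs: "xs \<in> peak_words Y S"
        and ys: "ys \<in> peak_words (A - Y) T" and w: "w = xs @ ys" by auto
      have "length xs = k" using xs Y by (simp add: length_peak_words)
      then show "w \<in> ?W" using xs ys Y
        by (auto simp: w peak_words_def permutations_of_set_def)
    qed
    show "(\<lambda>w. (set (take k w), take k w, drop k w)) ` ?W \<subseteq> ?X"
    proof
      fix z assume "z \<in> (\<lambda>w. (set (take k w), take k w, drop k w)) ` ?W"
      then obtain w where z: "z = (set (take k w), take k w, drop k w)" and w: "w \<in> ?W" by blast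
      have d: "distinct (take k w @ drop k w)" and s: "set (take k w @ drop k w) = A"
        using w by (auto simp: permutations_of_set_def simp del: distinct_append set_append)
      then have "set (drop k w) = A - set (take k w)" "set (take k w) \<subseteq> A"
        by (auto simp del: append_take_drop_id)
      moreover have "card (set (take k w)) = k"
        using d len[of w] w k by (subst distinct_card) auto
      ultimately show "z \<in> ?X"
        using w d unfolding z by (auto simp: peak_words_def permutations_of_set_def)
    qed
  qed
  then have "card ?W = card ?X" by (simp add: bij_betw_same_card)
  also have "\<dots> = (\<Sum>Y\<in>?Y. card (peak_words Y S \<times> peak_words (A - Y) T))"
    using A by (intro card_SigmaI) (auto intro: finite_subset[of _ "Pow A"])
  also have "\<dots> = (\<Sum>Y\<in>?Y. card (peak_words {1..k} S) * card (peak_words {1..n - k} T))"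
  proof (rule sum.cong[OF refl])
    fix Y assume Y: "Y \<in> ?Y"
    then have "finite Y" using A finite_subset by blast
    then have "card (peak_words Y S) = card (peak_words {1..k} S)"
      "card (peak_words (A - Y) T) = card (peak_words {1..n - k} T)"
      using Y A by (auto intro!: card_peak_words_cong simp: card_Diff_subset)
    then show "card (peak_words Y S \<times> peak_words (A - Y) T) =
        card (peak_words {1..k} S) * card (peak_words {1..n - k} T)"
      by (simp add: card_cartesian_product)
  qed
  also have "\<dots> = (n choose k) * card (peak_words {1..k} S) * card (peak_words {1..n - k} T)"
    using A by (simp add: n_subsets)
  finally show ?thesis .
qed

text \<open>Cut a word after position \<open>k\<close>. If the left part has peak set \<open>S\<close> and the right part
  has none, the only freedom left is a peak at \<open>k\<close> or \<open>k + 1\<close>, and not at both.\<close>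

lemma card_peak_perms_recurrence:
  assumes S: "S \<subseteq> {..<k}" and k: "k < n"
  shows "card (peak_perms S n) + card (peak_perms (insert k S) n)
      + card (peak_perms (insert (k + 1) S) n)
    = (n choose k) * card (peak_perms S k) * 2 ^ (n - k - 1)"
proof -
  let ?W = "{w \<in> permutations_of_set {1..n}. list_peaks (take k w) = S \<and> list_peaks (drop k w) = {}}"
  let ?P = "\<lambda>S. peak_words {1..n} S"
  have eq: "list_peaks (take k w) = S \<and> list_peaks (drop k w) = {} \<longleftrightarrow>
      list_peaks w = S \<or> list_peaks w = insert k S \<or> list_peaks w = insert (k + 1) S" for w :: "nat list"
  proof
    assume *: "list_peaks (take k w) = S \<and> list_peaks (drop k w) = {}"
    then have lo: "list_peaks w \<inter> {..<k} = S" by (simp add: list_peaks_take)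
    have hi: "i \<notin> list_peaks w" if "i > k + 1" for i
    proof -
      have "\<not> (1 < i - k \<and> k + (i - k) \<in> list_peaks w)"
        using * unfolding list_peaks_drop by blast
      then show ?thesis using that by auto
    qed
    have mid: "list_peaks w = S \<union> (list_peaks w \<inter> {k, k + 1})"
    proof (intro set_eqI)
      fix i show "i \<in> list_peaks w \<longleftrightarrow> i \<in> S \<union> (list_peaks w \<inter> {k, k + 1})"
        using lo hi[of i] by (cases i "k" rule: linorder_cases; cases "i = k + 1") auto
    qed
    show "list_peaks w = S \<or> list_peaks w = insert k S \<or> list_peaks w = insert (k + 1) S"
      using mid list_peaks_Suc_notin[of k w]
      by (cases "k \<in> list_peaks w"; cases "k + 1 \<in> list_peaks w") auto
  next
    assume "list_peaks w = S \<or> list_peaks w = insert k S \<or> list_peaks w = insert (k + 1) S"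
    then show "list_peaks (take k w) = S \<and> list_peaks (drop k w) = {}"
      using S unfolding list_peaks_take list_peaks_drop by auto
  qed
  have "?W = ?P S \<union> ?P (insert k S) \<union> ?P (insert (k + 1) S)"
    unfolding eq peak_words_def by blast
  \<comment> \<open>As \<open>S\<close> contains neither \<open>k\<close> nor \<open>k + 1\<close>,
    the three peak sets differ and the three classes are disjoint.\<close>
  moreover have "S \<noteq> insert k S" "S \<noteq> insert (k + 1) S" "insert k S \<noteq> insert (k + 1) S"
    using S by auto
  then have "?P S \<inter> ?P (insert k S) = {}" "(?P S \<union> ?P (insert k S)) \<inter> ?P (insert (k + 1) S) = {}"
    unfolding peak_words_def by blast+
  ultimately have "card ?W = card (?P S) + card (?P (insert k S)) + card (?P (insert (k + 1) S))"
    by (simp only: card_Un_disjoint finite_peak_words finite_UnI)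
  \<comment> \<open>The right part has \<open>n - k \<ge> 1\<close> entries and no peaks.\<close>
  moreover have "card ?W = (n choose k) * card (peak_words {1..k} S) * 2 ^ (n - k - 1)"
    using k by (subst card_words_split) (auto simp: card_peak_words_empty)
  ultimately show ?thesis by (simp add: card_peak_perms)
qed

section \<open>Counts for the peak sets \<open>{2}\<close>, \<open>{2, m}\<close> and
  \<open>{2, m, m + 2}\<close>\<close>

lemma card_peak_perms_empty: "n \<ge> 1 \<Longrightarrow> card (peak_perms {} n) = 2 ^ (n - 1)"
  by (simp add: card_peak_perms card_peak_words_empty)

text \<open>Peaks are interior positions and never adjacent. This removes impossible summands from
  the recurrence.\<close>

lemma peak_perms_eq_empty:
  assumes "i \<in> S" "i \<le> 1 \<or> i \<ge> n \<or> Suc i \<in> S"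
  shows "peak_perms S n = {}"
  using assms by (auto simp: peak_perms_def peaks_def)

text \<open>The recurrence with \<open>S = {}\<close> and \<open>k = 1\<close>: position 1 is never
  a peak, so only the summands for \<open>{}\<close> and \<open>{2}\<close> remain.\<close>

lemma card_peak_perms_2:
  assumes "n \<ge> 2"
  shows "card (peak_perms {2} n) = (n - 2) * 2 ^ (n - 2)"
proof -
  have "card (peak_perms {} n) + card (peak_perms {1} n) + card (peak_perms {2} n)
      = n * 2 ^ (n - 2)"
    using card_peak_perms_recurrence[of "{}" 1 n] assms
    by (simp add: card_peak_perms_empty numeral_2_eq_2)
  moreover have "card (peak_perms {} n) = 2 * 2 ^ (n - 2)"
    using assms power_Suc[of "2::nat" "n - 2"] by (simp add: card_peak_perms_empty Suc_diff_Suc numeral_2_eq_2)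
  moreover have "peak_perms {1} n = {}" by (rule peak_perms_eq_empty[of 1]) auto
  ultimately show ?thesis by (simp add: diff_mult_distrib)
qed

text \<open>Pascal's rule applied twice. It reconciles \<open>n choose m\<close> from the recurrence
  with the upper index \<open>n - 2\<close> of the closed form.\<close>

lemma binomial_add_2:
  "(Suc (Suc N) choose Suc (Suc j)) = (N choose Suc (Suc j)) + 2 * (N choose Suc j) + (N choose j)"
  by simp

text \<open>The degenerate case \<open>m = 3\<close>, in which both sides vanish, starts the induction.\<close>

lemma card_peak_perms_2_m:
  assumes "m \<ge> 3" "n > m"
  shows "real (card (peak_perms {2, m} n)) =
    ((real m - 3) * real ((n - 2) choose (m - 1)) + (real m - 2) * real ((n - 2) choose (m - 2))
      - (real n - 2)) * 2 ^ (n - 3)"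
  using assms
proof (induction m rule: dec_induct)
  case base
  have "peak_perms {2, 3} n = {}" by (rule peak_perms_eq_empty[of 2]) auto
  then show ?case using base by simp
next
  case (step m)
  obtain N where N: "n = Suc (Suc (Suc N))"
    using that[of "n - 3"] step.hyps step.prems by linarith
  obtain j where j: "m = Suc (Suc (Suc j))"
    using that[of "m - 3"] step.hyps by linarith
  have "card (peak_perms {2} n) + card (peak_perms {2, m} n) + card (peak_perms {2, Suc m} n)
      = (n choose m) * card (peak_perms {2} m) * 2 ^ (n - m - 1)"
    using card_peak_perms_recurrence[of "{2}" m n] step by (simp add: insert_commute)
  from this[THEN arg_cong, of real] have rec: "real (card (peak_perms {2, Suc m} n)) =
      real (n choose m) * real (card (peak_perms {2} m)) * 2 ^ (n - m - 1)
      - real (card (peak_perms {2} n)) - real (card (peak_perms {2, m} n))"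
    by (simp only: of_nat_add of_nat_mult of_nat_power of_nat_numeral)
  \<comment> \<open>The powers of 2 from \<open>peak_perms {2} m\<close> and from the peak-free
    right part combine to \<open>2 ^ (n - 3)\<close>.\<close>
  have "m - 2 + (n - m - 1) = n - 3" using step by simp
  then have pow: "(2::real) ^ (m - 2) * 2 ^ (n - m - 1) = 2 ^ (n - 3)"
    by (metis power_add)
  have c1: "real (n choose m) * real (card (peak_perms {2} m)) * 2 ^ (n - m - 1)
      = real (n choose m) * (real m - 2) * 2 ^ (n - 3)"
    unfolding pow[symmetric] using step by (simp add: card_peak_perms_2 of_nat_diff)
  have c2: "real (card (peak_perms {2} n)) = 2 * (real n - 2) * 2 ^ (n - 3)"
    using N by (simp add: card_peak_perms_2 algebra_simps)
  have IH: "real (card (peak_perms {2, m} n)) =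
    ((real m - 3) * real ((n - 2) choose (m - 1)) + (real m - 2) * real ((n - 2) choose (m - 2))
      - (real n - 2)) * 2 ^ (n - 3)" using step by simp
  have binom: "real (n choose m) = real ((n - 2) choose m) + 2 * real ((n - 2) choose (m - 1))
      + real ((n - 2) choose (m - 2))"
    using binomial_add_2[of "Suc N" "Suc j"] N j by (simp del: binomial_Suc_Suc)
  have Suc_m: "real (Suc m) = real m + 1" "Suc m - 1 = m" "Suc m - 2 = m - 1" by simp_all
  \<comment> \<open>The coefficients at lower index \<open>m\<close>, \<open>m - 1\<close>,
    \<open>m - 2\<close> become \<open>m - 2\<close>, \<open>2 * (m - 2) - (m - 3) = m - 1\<close>
    and \<open>0\<close>; the linear part is \<open>-2 * (n - 2) + (n - 2)\<close>.\<close>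
  show ?case unfolding rec c1 c2 IH unfolding binom Suc_m by algebra
qed

lemma card_peak_perms_2_m_m2:
  assumes "m \<ge> 4" "n \<ge> m + 2"
  shows "real (card (peak_perms {2, m, m + 2} n)) =
    (real m * (real m - 3) * real (n choose (m + 1))
      - 2 * (real m - 3) * real ((n - 2) choose (m - 1))
      - 2 * (real m - 2) * real ((n - 2) choose (m - 2))
      + 2 * (real n - 2)) * 2 ^ (n - 4)"
proof -
  have "peak_perms {2, m, m + 1} n = {}" by (rule peak_perms_eq_empty[of m]) auto
  moreover have "card (peak_perms {2, m} n) + card (peak_perms {2, m, m + 1} n)
      + card (peak_perms {2, m, m + 2} n)
      = (n choose (m + 1)) * card (peak_perms {2, m} (m + 1)) * 2 ^ (n - m - 2)"
    using card_peak_perms_recurrence[of "{2, m}" "m + 1" n] assms by (simp add: insert_commute)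
  ultimately have "real (card (peak_perms {2, m} n) + card (peak_perms {2, m, m + 2} n)) =
      real ((n choose (m + 1)) * card (peak_perms {2, m} (m + 1)) * 2 ^ (n - m - 2))"
    by simp
  then have rec: "real (card (peak_perms {2, m, m + 2} n)) =
      real (n choose (m + 1)) * real (card (peak_perms {2, m} (m + 1))) * 2 ^ (n - m - 2)
      - real (card (peak_perms {2, m} n))"
    by (simp only: of_nat_add of_nat_mult of_nat_power of_nat_numeral)
  have "m - 2 + (n - m - 2) = n - 4" using assms by simp
  then have pow: "(2::real) ^ (m - 2) * 2 ^ (n - m - 2) = 2 ^ (n - 4)"
    by (metis power_add)
  \<comment> \<open>At \<open>n = m + 1\<close> the closed form has the factor
    \<open>(m - 3) + (m - 2) * (m - 1) - (m - 1) = m * (m - 3)\<close>, the leading coefficient of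
    the result.\<close>
  have "(m - 1) choose (m - 2) = m - 1"
    using assms binomial_symmetric[of 1 "m - 1"] by (simp add: numeral_2_eq_2)
  then have "real (card (peak_perms {2, m} (m + 1))) = real m * (real m - 3) * 2 ^ (m - 2)"
    using card_peak_perms_2_m[of m "m + 1"] assms by (simp add: of_nat_diff algebra_simps)
  then have c1: "real (n choose (m + 1)) * real (card (peak_perms {2, m} (m + 1))) * 2 ^ (n - m - 2)
      = real m * (real m - 3) * real (n choose (m + 1)) * 2 ^ (n - 4)"
    unfolding pow[symmetric] by simp
  \<comment> \<open>This doubling produces the factors 2 in the last three terms.\<close>
  have "(2::real) ^ (n - 3) = 2 * 2 ^ (n - 4)"
    using assms power_Suc[of "2::real" "n - 4"] by (simp add: Suc_diff_Suc eval_nat_numeral)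
  then have c2: "real (card (peak_perms {2, m} n)) =
    ((real m - 3) * real ((n - 2) choose (m - 1)) + (real m - 2) * real ((n - 2) choose (m - 2))
      - (real n - 2)) * (2 * 2 ^ (n - 4))"
    using card_peak_perms_2_m[of m n] assms by simp
  show ?thesis unfolding rec c1 c2 by algebra
qed

section \<open>The peak polynomial\<close>

text \<open>The generalized binomial is a product of \<open>k\<close> linear factors divided by
  \<open>fact k\<close>. Hence the closed form is a polynomial in a real variable.\<close>

lemma ex_poly_gchoose: "\<exists>p::real poly. \<forall>x. poly p x = ((x - a) gchoose k)"
proof
  show "\<forall>x. poly (smult (1 / fact k) (\<Prod>i = 0..<k. [:- a - of_nat i, 1:])) x = ((x - a) gchoose k)"
    by (simp add: gbinomial_prod_rev poly_prod algebra_simps)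
qed

text \<open>Since powers of 2 are nonzero, \<open>p\<close> and \<open>q\<close> agree at all large
  integers, so \<open>p - q\<close> has infinitely many roots. This justifies the definite
  description in \<open>peak_poly\<close>.\<close>

lemma is_peak_poly_unique:
  assumes "is_peak_poly S p" "is_peak_poly S q"
  shows "p = q"
proof (rule ccontr)
  assume "p \<noteq> q"
  then have "finite {x. poly (p - q) x = 0}" by (intro poly_roots_finite) simp
  moreover have "real ` {Max (insert 0 S)<..} \<subseteq> {x. poly (p - q) x = 0}"
    using assms by (force simp: is_peak_poly_def)
  ultimately have "finite (real ` {Max (insert 0 S)<..})" by (rule rev_finite_subset)
  then show False by (simp add: finite_image_iff infinite_Ioi)
qed

theorem theorem3p3:
  fixes m :: nat
  assumes "m \<ge> 4"
  shows "admissible {2, m, m + 2}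
    \<and> (\<forall>x::real. poly (peak_poly {2, m, m + 2}) x =
           real m * (real m - 3) * (x gchoose (m + 1))
         - 2 * (real m - 3) * ((x - 2) gchoose (m - 1))
         - 2 * (real m - 2) * ((x - 2) gchoose (m - 2))
         + 2 * ((x - 2) gchoose 1))
    \<and> (\<forall>n\<ge>m + 3. real (card (peak_perms {2, m, m + 2} n)) =
           poly (peak_poly {2, m, m + 2}) (real n) * 2 ^ (n - 4))"
proof -
  let ?S = "{2, m, m + 2}"
  let ?f = "\<lambda>x::real. real m * (real m - 3) * (x gchoose (m + 1))
         - 2 * (real m - 3) * ((x - 2) gchoose (m - 1))
         - 2 * (real m - 2) * ((x - 2) gchoose (m - 2))
         + 2 * ((x - 2) gchoose 1)"
  have Max: "Max (insert 0 ?S) = m + 2" using assms by (intro Max_eqI) auto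
  have card: "card ?S = 3" using assms by simp
  have count: "real (card (peak_perms ?S n)) = ?f (real n) * 2 ^ (n - 4)" if "n \<ge> m + 2" for n
  proof -
    \<comment> \<open>No truncation occurs here, so natural binomials may be read as generalized
      ones at \<open>real n - 2\<close>.\<close>
    have eq: "real (n - 2) = real n - 2" using that by (simp add: of_nat_diff)
    show ?thesis using card_peak_perms_2_m_m2[OF assms that]
      unfolding binomial_gbinomial eq gbinomial_1 .
  qed
  obtain p :: "real poly" where p: "\<And>x. poly p x = (x gchoose (m + 1))"
    using ex_poly_gchoose[of 0] by auto
  obtain q :: "nat \<Rightarrow> real poly" where q: "\<And>k x. poly (q k) x = ((x - 2) gchoose k)"
    using ex_poly_gchoose[of 2] by metis
  have "poly (smult (real m * (real m - 3)) p - smult (2 * (real m - 3)) (q (m - 1))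
      - smult (2 * (real m - 2)) (q (m - 2)) + smult 2 (q 1)) x = ?f x" for x
    by (simp add: p q)
  then obtain P where P: "\<And>x. poly P x = ?f x" by blast
  \<comment> \<open>With three peaks the exponent \<open>n - card ?S - 1\<close> is
    \<open>n - 4\<close>.\<close>
  have "is_peak_poly ?S P"
    unfolding is_peak_poly_def Max card P using count by simp
  then have "peak_poly ?S = P"
    unfolding peak_poly_def using is_peak_poly_unique by blast
  \<comment> \<open>The witness is \<open>n = m + 3\<close>, the least length in which
    \<open>m + 2\<close> is an interior position; the closed form is shown to be positive
    there.\<close>
  moreover have "admissible ?S"
  proof -
    \<comment> \<open>Written in \<open>t = m - 4\<close>, the closed form becomes a polynomial with
      positive coefficients.\<close>
    obtain t where t: "m = t + 4" using assms by (metis add.commute le_Suc_ex)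
    have b: "(m + 3) choose (m + 1) = (m + 3) choose 2" "(m + 1) choose (m - 1) = (m + 1) choose 2"
      "(m + 1) choose (m - 2) = (m + 1) choose 3"
      using assms binomial_symmetric[of 2 "m + 3"] binomial_symmetric[of 2 "m + 1"]
        binomial_symmetric[of 3 "m + 1"] by simp_all
    have "2 * real ((m + 3) choose 2) = (real m + 3) * (real m + 2)"
      "2 * real ((m + 1) choose 2) = (real m + 1) * real m"
      "6 * real ((m + 1) choose 3) = (real m + 1) * real m * (real m - 1)"
      unfolding binomial_gbinomial by (simp_all add: gbinomial_prod_rev numeral_eq_Suc ac_simps)
    \<comment> \<open>The factor 6 clears the denominators of the binomials.\<close>
    then have "6 * (real m * (real m - 3) * real ((m + 3) choose 2)
      - 2 * (real m - 3) * real ((m + 1) choose 2)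
      - 2 * (real m - 2) * real ((m + 1) choose 3) + 2 * (real m + 1))
      = 3 * real m * (real m - 3) * ((real m + 3) * (real m + 2))
      - 6 * (real m - 3) * ((real m + 1) * real m)
      - 2 * (real m - 2) * ((real m + 1) * real m * (real m - 1)) + 12 * (real m + 1)"
      by algebra
    also have "\<dots> = 204 + 316 * real t + 131 * real t ^ 2 + 20 * real t ^ 3 + real t ^ 4"
    proof -
      have "real m = real t + 4" using t by simp
      then show ?thesis by algebra
    qed
    also have "\<dots> > 0"
      by (intro add_pos_nonneg) simp_all
    finally have "0 < real m * (real m - 3) * real ((m + 3) choose 2)
      - 2 * (real m - 3) * real ((m + 1) choose 2)
      - 2 * (real m - 2) * real ((m + 1) choose 3) + 2 * (real m + 1)"
      by simp
    moreover have "m + 3 - 2 = m + 1" "real (m + 3) - 2 = real m + 1" "m + 2 \<le> m + 3" by simp_all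
    note card_peak_perms_2_m_m2[OF assms this(3), unfolded this(1,2) b]
    ultimately have "real (card (peak_perms ?S (m + 3))) > 0" by simp
    then show ?thesis unfolding admissible_def by (intro exI[of _ "m + 3"]) simp
  qed
  ultimately show ?thesis using P count by simp
qed

end
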